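(* Let $X$ be a hypergraph, $G$ a group, and $k,\ell$ positive integers. Then $X$ is $k$-uniform and $\ell$-regular and $G$ acts (by hypergraph automorphisms) regularly on the vertex set of $X$ if and only if there exists a collection $\mathcal{C}=\{C_1,\dots,C_\ell\}$ of $\ell$ distinct subsets of $G$, each of size $k$ and containing the identity $e$, satisfying the $T$-axiom, such that $X$ is isomorphic to the group hypergraph $CH(G,\mathcal{C})$.
   Context: A hypergraph consists of a vertex set and a set of nonempty subsets (hyperedges); it is $k$-uniform if every hyperedge has size $k$ and $\ell$-regular if every vertex lies in exactly $\ell$ hyperedges. For $C\subseteq G$ and $g\in G$, $gC=\{gs:s\in C\}$. A collection of subsets of $G$, each containing $e$, satisfies the $T$-axiom if for every $C$ in it and every $s\in C$, $s^{-1}C$ is also in it. For a collection $\mathcal{C}$ of nonempty subsets of $G$, the group hypergraph $CH(G,\mathcal{C})$ has vertex set $G$ and hyperedge set $\{gC: g\in G, C\in\mathcal{C}\}$. *)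

theory Defs
  imports "HOL-Algebra.Group_Action"
begin

record 'v hypergraph =
  verts :: "'v set"
  hedges :: "'v set set"

definition is_hypergraph :: "'v hypergraph \<Rightarrow> bool" where
  "is_hypergraph X \<longleftrightarrow> (\<forall>E\<in>hedges X. E \<subseteq> verts X \<and> E \<noteq> {})"

(* The vertex set may be infinite; the finiteness conjuncts below are needed because
   card is 0 on infinite sets. *)

definition uniform :: "nat \<Rightarrow> 'v hypergraph \<Rightarrow> bool" where
  "uniform k X \<longleftrightarrow> (\<forall>E\<in>hedges X. finite E \<and> card E = k)"

definition regular :: "nat \<Rightarrow> 'v hypergraph \<Rightarrow> bool" where
  "regular l X \<longleftrightarrow>
     (\<forall>v\<in>verts X. finite {E \<in> hedges X. v \<in> E} \<and> card {E \<in> hedges X. v \<in> E} = l)"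

definition hypergraph_iso :: "'v hypergraph \<Rightarrow> 'w hypergraph \<Rightarrow> ('v \<Rightarrow> 'w) \<Rightarrow> bool" where
  "hypergraph_iso X Y f \<longleftrightarrow>
     bij_betw f (verts X) (verts Y) \<and> (\<lambda>E. f ` E) ` hedges X = hedges Y"

definition isomorphic :: "'v hypergraph \<Rightarrow> 'w hypergraph \<Rightarrow> bool" where
  "isomorphic X Y \<longleftrightarrow> (\<exists>f. hypergraph_iso X Y f)"

(* A regular (= simply transitive) action is a transitive action on a nonempty set with trivial
   point stabilizers. Nonemptiness is stated because transitive_action holds vacuously
   on the empty set. *)
definition regular_action ::
    "('g, 'm) monoid_scheme \<Rightarrow> 'v set \<Rightarrow> ('g \<Rightarrow> 'v \<Rightarrow> 'v) \<Rightarrow> bool" where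
  "regular_action G V \<phi> \<longleftrightarrow>
     transitive_action G V \<phi> \<and> V \<noteq> {} \<and> (\<forall>v\<in>V. stabilizer G \<phi> v = {\<one>\<^bsub>G\<^esub>})"

definition acts_by_automorphisms ::
    "('g, 'm) monoid_scheme \<Rightarrow> 'v hypergraph \<Rightarrow> ('g \<Rightarrow> 'v \<Rightarrow> 'v) \<Rightarrow> bool" where
  "acts_by_automorphisms G X \<phi> \<longleftrightarrow>
     group_action G (verts X) \<phi> \<and> (\<forall>g\<in>carrier G. hypergraph_iso X X (\<phi> g))"

definition T_axiom :: "('g, 'm) monoid_scheme \<Rightarrow> 'g set set \<Rightarrow> bool" where
  "T_axiom G \<C> \<longleftrightarrow> (\<forall>C\<in>\<C>. \<forall>s\<in>C. inv\<^bsub>G\<^esub> s <#\<^bsub>G\<^esub> C \<in> \<C>)"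

definition group_hypergraph :: "('g, 'm) monoid_scheme \<Rightarrow> 'g set set \<Rightarrow> 'g hypergraph" where
  "group_hypergraph G \<C> =
     \<lparr>verts = carrier G, hedges = {g <#\<^bsub>G\<^esub> C | g C. g \<in> carrier G \<and> C \<in> \<C>}\<rparr>"

end

theory Submission
  imports Defs
begin

text \<open>
  A regular action identifies the vertex set with \<open>G\<close> via \<open>g \<mapsto> g x\<^sub>0\<close>, and the action becomes left
  translation. A hypergraph on \<open>G\<close> whose edge set is invariant under left translation is the group
  hypergraph of the set of its edges through the identity, and this set satisfies the T-axiom.
  Conversely, by the T-axiom the edges of a group hypergraph through \<open>v\<close> are exactly the sets \<open>vC\<close>
  with \<open>C \<in> \<C>\<close>, so their number is the cardinality of \<open>\<C>\<close>; left translations act regularly.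
\<close>

section \<open>Hypergraph isomorphisms\<close>

lemma hypergraph_isoD:
  assumes "hypergraph_iso X Y f"
  shows "bij_betw f (verts X) (verts Y)" "inj_on f (verts X)" "f ` verts X = verts Y"
    "hedges Y = (`) f ` hedges X"
  using assms by (auto simp: hypergraph_iso_def bij_betw_def)

lemma is_hypergraph_iso:
  assumes "hypergraph_iso X Y f" "is_hypergraph X"
  shows "is_hypergraph Y"
  using assms(2) hypergraph_isoD(3,4)[OF assms(1)]
  unfolding is_hypergraph_def by fastforce

text \<open>\<open>hypergraph_iso\<close> controls \<open>f\<close> only on \<open>verts X\<close>.
  Since \<open>is_hypergraph X\<close> puts every edge inside \<open>verts X\<close>, the inverse on
  vertices also undoes \<open>f\<close> on edges.\<close>

lemma hypergraph_iso_inv_into: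
  assumes iso: "hypergraph_iso X Y f" and X: "is_hypergraph X"
  shows "hypergraph_iso Y X (inv_into (verts X) f)"
proof -
  have "inv_into (verts X) f ` f ` E = E" if "E \<in> hedges X" for E
    using X that hypergraph_isoD(2)[OF iso]
    by (intro inv_into_image_cancel) (auto simp: is_hypergraph_def)
  then have "(`) (inv_into (verts X) f) ` hedges Y = hedges X"
    by (force simp: hypergraph_isoD(4)[OF iso] image_image)
  then show ?thesis
    using bij_betw_inv_into[OF hypergraph_isoD(1)[OF iso]] by (simp add: hypergraph_iso_def)
qed

lemma hypergraph_iso_comp:
  assumes "hypergraph_iso X Y f" "hypergraph_iso Y Z g"
  shows "hypergraph_iso X Z (g \<circ> f)"
proof -
  have "(`) (g \<circ> f) ` hedges X = hedges Z"
    using hypergraph_isoD(4)[OF assms(1)] hypergraph_isoD(4)[OF assms(2)]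
    by (simp add: image_image image_comp comp_def)
  then show ?thesis
    using bij_betw_trans[OF hypergraph_isoD(1)[OF assms(1)] hypergraph_isoD(1)[OF assms(2)]]
    by (simp add: hypergraph_iso_def)
qed

text \<open>Group actions consist of extensional maps, so an action map built by restriction agrees
  with the intended composite on vertices only. Edges consist of vertices, so this agreement
  suffices.\<close>

lemma hypergraph_iso_cong:
  assumes "is_hypergraph X" "\<And>v. v \<in> verts X \<Longrightarrow> f v = g v"
  shows "hypergraph_iso X Y f \<longleftrightarrow> hypergraph_iso X Y g"
proof -
  have "f ` E = g ` E" if "E \<in> hedges X" for E
    using assms that by (intro image_cong) (auto simp: is_hypergraph_def)
  then have "(`) f ` hedges X = (`) g ` hedges X"
    by (rule image_cong[OF refl])
  then show ?thesis
    using bij_betw_cong[of "verts X" f g "verts Y"] assms(2) by (simp add: hypergraph_iso_def)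
qed

lemma uniform_iso:
  assumes iso: "hypergraph_iso X Y f" and X: "is_hypergraph X" and "uniform k X"
  shows "uniform k Y"
proof -
  have "card (f ` E) = card E" if "E \<in> hedges X" for E
    using X that hypergraph_isoD(2)[OF iso]
    by (intro card_image) (auto simp: is_hypergraph_def intro: inj_on_subset)
  then show ?thesis
    using \<open>uniform k X\<close> by (auto simp: uniform_def hypergraph_isoD(4)[OF iso])
qed

lemma regular_iso:
  assumes iso: "hypergraph_iso X Y f" and X: "is_hypergraph X" and reg: "regular l X"
  shows "regular l Y"
  unfolding regular_def
proof
  fix w assume "w \<in> verts Y"
  then obtain v where v: "v \<in> verts X" "w = f v"
    using hypergraph_isoD(3)[OF iso] by auto
  have mem: "f v \<in> f ` E \<longleftrightarrow> v \<in> E" if "E \<in> hedges X" for E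
    using X that v hypergraph_isoD(2)[OF iso]
    by (intro inj_on_image_mem_iff) (auto simp: is_hypergraph_def)
  have edges: "{E \<in> hedges Y. w \<in> E} = (`) f ` {E \<in> hedges X. v \<in> E}"
    using mem v by (auto simp: hypergraph_isoD(4)[OF iso])
  \<comment> \<open>Taking images under a map injective on the vertices is injective on sets of
    vertices, so no two edges through \<open>v\<close> merge and their number is kept.\<close>
  have "{E \<in> hedges X. v \<in> E} \<subseteq> Pow (verts X)"
    using X by (auto simp: is_hypergraph_def)
  then have "inj_on ((`) f) {E \<in> hedges X. v \<in> E}"
    by (rule inj_on_subset[OF inj_on_image_Pow[OF hypergraph_isoD(2)[OF iso]]])
  then show "finite {E \<in> hedges Y. w \<in> E} \<and> card {E \<in> hedges Y. w \<in> E} = l"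
    using reg v unfolding edges regular_def by (simp add: card_image)
qed

section \<open>Group actions\<close>

text \<open>A pointwise criterion: \<open>group_action\<close> asks for a homomorphism into
  \<open>BijGroup E\<close>, whose elements are extensional bijections. Bijectivity of
  \<open>\<phi> g\<close> is automatic, because \<open>\<phi> (inv g)\<close> inverts it.\<close>

lemma (in group) group_actionI:
  assumes ext: "\<And>g. g \<in> carrier G \<Longrightarrow> \<phi> g \<in> extensional E"
    and closed: "\<And>g x. \<lbrakk>g \<in> carrier G; x \<in> E\<rbrakk> \<Longrightarrow> \<phi> g x \<in> E"
    and one: "\<And>x. x \<in> E \<Longrightarrow> \<phi> \<one> x = x"
    and mult: "\<And>g h x. \<lbrakk>g \<in> carrier G; h \<in> carrier G; x \<in> E\<rbrakk> \<Longrightarrow> \<phi> (g \<otimes> h) x = \<phi> g (\<phi> h x)"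
  shows "group_action G E \<phi>"
proof -
  have inv: "\<phi> (inv g) (\<phi> g x) = x" "\<phi> g (\<phi> (inv g) x) = x" if "g \<in> carrier G" "x \<in> E" for g x
    using that mult[of "inv g" g x] mult[of g "inv g" x] one by auto
  have bij: "\<phi> g \<in> Bij E" if "g \<in> carrier G" for g
  proof -
    have "bij_betw (\<phi> g) E E"
      by (rule bij_betw_byWitness[where f' = "\<phi> (inv g)"]) (use that inv closed in auto)
    then show ?thesis
      using ext[OF that] by (simp add: Bij_def)
  qed
  \<comment> \<open>Both sides are extensional on \<open>E\<close>, so comparing values on
    \<open>E\<close> is enough.\<close>
  have "\<phi> (g \<otimes> h) = compose E (\<phi> g) (\<phi> h)" if "g \<in> carrier G" "h \<in> carrier G" for g h
    using that ext mult by (intro extensionalityI[of _ E]) (auto simp: compose_def)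
  then have "\<phi> \<in> hom G (BijGroup E)"
    using bij by (auto simp: hom_def BijGroup_def)
  then show ?thesis
    by (intro group_action.intro group_hom.intro group_hom_axioms.intro
        group_BijGroup is_group)
qed

text \<open>The orbit map at \<open>x\<close> is onto by transitivity. It is injective because two
  group elements with the same value at \<open>x\<close> differ by an element of the
  stabilizer.\<close>

lemma (in transitive_action) regular_action_bij_betw:
  assumes x: "x \<in> E" and stab: "stabilizer G \<phi> x = {\<one>}"
  shows "bij_betw (\<lambda>g. \<phi> g x) (carrier G) E"
proof -
  interpret group G
    using group_hom group_hom.axioms(1) by auto
  have "g = h" if "g \<in> carrier G" "h \<in> carrier G" "\<phi> g x = \<phi> h x" for g h
  proof -
    have "\<phi> (inv h \<otimes> g) x = x"
      using that x orbit_sym_aux[of h x] by (simp add: composition_rule)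
    then have "inv h \<otimes> g \<in> stabilizer G \<phi> x"
      using that by (simp add: stabilizer_def)
    then have "inv h \<otimes> g = \<one>"
      using stab by blast
    then show ?thesis
      using that by (metis inv_closed inv_equality inv_inv)
  qed
  moreover have "(\<lambda>g. \<phi> g x) ` carrier G = E"
    using unique_orbit[OF x] element_image x by fastforce
  ultimately show ?thesis
    by (auto simp: bij_betw_def inj_on_def)
qed

section \<open>Group hypergraphs\<close>

lemma l_coset_eq_image: "g <#\<^bsub>G\<^esub> C = (\<lambda>s. g \<otimes>\<^bsub>G\<^esub> s) ` C"
  by (auto simp: l_coset_def)

context group
begin

lemma l_coset_one: "C \<subseteq> carrier G \<Longrightarrow> \<one> <# C = C"
  by (force simp: l_coset_eq_image)

text \<open>For any \<open>s\<close> in an edge \<open>E\<close>, the edge \<open>inv s <# E\<close>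
  contains \<open>\<one>\<close>, and translating it by \<open>s\<close> gives \<open>E\<close>
  back. Such an \<open>s\<close> exists because edges are nonempty.\<close>

lemma translation_invariant_imp_group_hypergraph:
  assumes verts: "verts Y = carrier G" and Y: "is_hypergraph Y"
    and inv: "\<And>g E. \<lbrakk>g \<in> carrier G; E \<in> hedges Y\<rbrakk> \<Longrightarrow> g <# E \<in> hedges Y"
  shows "T_axiom G {E \<in> hedges Y. \<one> \<in> E}" "Y = group_hypergraph G {E \<in> hedges Y. \<one> \<in> E}"
proof -
  have sub: "E \<subseteq> carrier G" "E \<noteq> {}" if "E \<in> hedges Y" for E
    using Y verts that by (auto simp: is_hypergraph_def)
  have one: "\<one> \<in> inv s <# E" if "E \<in> hedges Y" "s \<in> E" for E s
    using sub(1)[OF that(1)] that(2) l_inv by (force simp: l_coset_eq_image)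
  show "T_axiom G {E \<in> hedges Y. \<one> \<in> E}"
    using one inv sub(1) by (auto simp: T_axiom_def subset_iff)
  have "\<exists>g C. E = g <# C \<and> g \<in> carrier G \<and> C \<in> hedges Y \<and> \<one> \<in> C" if E: "E \<in> hedges Y" for E
  proof -
    obtain s where s: "s \<in> E" "s \<in> carrier G"
      using sub[OF E] by auto
    have "E = s <# (inv s <# E)"
      using s sub(1)[OF E] by (simp add: lcos_m_assoc l_coset_one)
    then show ?thesis
      using s one[OF E] inv[OF _ E] by blast
  qed
  then have "hedges Y = hedges (group_hypergraph G {E \<in> hedges Y. \<one> \<in> E})"
    using inv by (auto simp: group_hypergraph_def)
  then show "Y = group_hypergraph G {E \<in> hedges Y. \<one> \<in> E}"
    using verts by (simp add: group_hypergraph_def)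
qed

lemma inj_on_l_mult: "g \<in> carrier G \<Longrightarrow> inj_on (\<lambda>s. g \<otimes> s) (carrier G)"
  by (auto simp: inj_on_def)

lemma uniform_group_hypergraph:
  assumes "\<And>C. C \<in> \<C> \<Longrightarrow> C \<subseteq> carrier G \<and> finite C \<and> card C = k"
  shows "uniform k (group_hypergraph G \<C>)"
  using assms inj_on_subset[OF inj_on_l_mult]
  by (auto simp: uniform_def group_hypergraph_def l_coset_eq_image card_image)

lemma regular_group_hypergraph:
  assumes \<C>: "\<And>C. C \<in> \<C> \<Longrightarrow> C \<subseteq> carrier G \<and> \<one> \<in> C" and T: "T_axiom G \<C>" and fin: "finite \<C>"
  shows "regular (card \<C>) (group_hypergraph G \<C>)"
  unfolding regular_def
proof
  fix v assume "v \<in> verts (group_hypergraph G \<C>)"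
  then have v: "v \<in> carrier G"
    by (simp add: group_hypergraph_def)
  \<comment> \<open>If \<open>v = g \<otimes> s\<close> with \<open>s\<close> in \<open>C\<close>,
    then \<open>g <# C\<close> is the translate by \<open>v\<close> of \<open>inv s <# C\<close>,
    which the T-axiom places in \<open>\<C>\<close>.\<close>
  have "g <# C \<in> (\<lambda>C. v <# C) ` \<C>" if g: "g \<in> carrier G" and C: "C \<in> \<C>" and "v \<in> g <# C" for g C
  proof -
    obtain s where s: "s \<in> C" "v = g \<otimes> s" "s \<in> carrier G"
      using \<open>v \<in> g <# C\<close> \<C>[OF C] by (auto simp: l_coset_eq_image)
    have "v <# (inv s <# C) = g <# C"
      using s g \<C>[OF C] by (simp add: lcos_m_assoc m_assoc)
    moreover have "inv s <# C \<in> \<C>"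
      using T C s by (auto simp: T_axiom_def)
    ultimately show ?thesis
      by (metis imageI)
  qed
  moreover have "v \<in> v <# C" if "C \<in> \<C>" for C
    using \<C>[OF that] v by (force simp: l_coset_eq_image)
  ultimately have edges: "{E \<in> hedges (group_hypergraph G \<C>). v \<in> E} = (\<lambda>C. v <# C) ` \<C>"
    using v by (auto simp: group_hypergraph_def)
  \<comment> \<open>Distinct members of \<open>\<C>\<close> give distinct edges through
    \<open>v\<close>, so the count is exactly \<open>card \<C>\<close>.\<close>
  have "inj_on (\<lambda>C. v <# C) \<C>"
    unfolding l_coset_eq_image using \<C>
    by (intro inj_on_subset[OF inj_on_image_Pow[OF inj_on_l_mult[OF v]]]) auto
  then show "finite {E \<in> hedges (group_hypergraph G \<C>). v \<in> E} \<and>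
      card {E \<in> hedges (group_hypergraph G \<C>). v \<in> E} = card \<C>"
    using fin by (simp add: edges card_image)
qed

lemma hypergraph_iso_l_mult:
  assumes \<C>: "\<And>C. C \<in> \<C> \<Longrightarrow> C \<subseteq> carrier G" and g: "g \<in> carrier G"
  shows "hypergraph_iso (group_hypergraph G \<C>) (group_hypergraph G \<C>) (\<lambda>s. g \<otimes> s)"
proof -
  let ?H = "{h <# C | h C. h \<in> carrier G \<and> C \<in> \<C>}"
  have "bij_betw (\<lambda>s. g \<otimes> s) (carrier G) (carrier G)"
    using g by (intro bij_betw_byWitness[where f' = "\<lambda>s. inv g \<otimes> s"]) (auto simp: m_assoc[symmetric])
  moreover have closed: "h <# E \<in> ?H" if h: "h \<in> carrier G" and E: "E \<in> ?H" for h E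
  proof -
    obtain a C where aC: "E = a <# C" "a \<in> carrier G" "C \<in> \<C>"
      using E by blast
    then have "h <# E = (h \<otimes> a) <# C"
      using h \<C> by (simp add: lcos_m_assoc)
    then show ?thesis
      using aC h by blast
  qed
  \<comment> \<open>\<open>closed\<close> gives only that translation maps edges to edges; that
    every edge is hit follows by translating back with \<open>inv g\<close>.\<close>
  moreover have "E \<in> (\<lambda>E. g <# E) ` ?H" if "E \<in> ?H" for E
  proof
    have "E \<subseteq> carrier G"
      using that \<C> by (force simp: l_coset_eq_image)
    then show "E = g <# (inv g <# E)"
      using g by (simp add: lcos_m_assoc l_coset_one)
    show "inv g <# E \<in> ?H"
      using closed that g by blast
  qed
  ultimately have "bij_betw (\<lambda>s. g \<otimes> s) (carrier G) (carrier G)" "(\<lambda>E. g <# E) ` ?H = ?H"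
    using g by blast+
  then show ?thesis
    by (simp add: hypergraph_iso_def group_hypergraph_def l_coset_eq_image[symmetric])
qed

section \<open>From regular actions to group hypergraphs and back\<close>

lemma regular_action_imp_group_hypergraph:
  assumes X: "is_hypergraph X" and unif: "uniform k X" and reg: "regular l X"
    and auts: "acts_by_automorphisms G X \<phi>" and act: "regular_action G (verts X) \<phi>"
  shows "\<exists>\<C>. finite \<C> \<and> card \<C> = l \<and>
    (\<forall>C\<in>\<C>. C \<subseteq> carrier G \<and> finite C \<and> card C = k \<and> \<one> \<in> C) \<and>
    T_axiom G \<C> \<and> isomorphic X (group_hypergraph G \<C>)"
proof -
  interpret transitive_action G "verts X" \<phi>
    using act by (simp add: regular_action_def)
  obtain x where x: "x \<in> verts X" "stabilizer G \<phi> x = {\<one>}"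
    using act by (auto simp: regular_action_def)
  define f where "f = (\<lambda>g. \<phi> g x)"
  have f: "bij_betw f (carrier G) (verts X)"
    unfolding f_def by (rule regular_action_bij_betw[OF x])
  define h where "h = inv_into (carrier G) f"
  \<comment> \<open>\<open>Y\<close> is the copy of \<open>X\<close> on \<open>carrier G\<close>,
    transported along the inverse of the orbit map at \<open>x\<close>.\<close>
  define Y where "Y = \<lparr>verts = carrier G, hedges = (`) h ` hedges X\<rparr>"
  have iso: "hypergraph_iso X Y h"
    using bij_betw_inv_into[OF f] by (simp add: Y_def h_def hypergraph_iso_def)
  note Y = is_hypergraph_iso[OF iso X] uniform_iso[OF iso X unif] regular_iso[OF iso X reg]
  \<comment> \<open>Under \<open>h\<close> the action becomes left multiplication, so invariance of
    the edges of \<open>X\<close> under \<open>\<phi>\<close> turns into translation invariance of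
    the edges of \<open>Y\<close>.\<close>
  have h_mult: "h (\<phi> g v) = g \<otimes> h v" if g: "g \<in> carrier G" and v: "v \<in> verts X" for g v
  proof -
    obtain a where a: "a \<in> carrier G" "v = f a"
      using v f by (auto simp: bij_betw_def)
    have "\<phi> g v = f (g \<otimes> a)"
      using a g x by (simp add: f_def composition_rule)
    then show ?thesis
      using a g f by (simp add: h_def bij_betw_def inv_into_f_f)
  qed
  have inv: "g <# E \<in> hedges Y" if g: "g \<in> carrier G" and E: "E \<in> hedges Y" for g E
  proof -
    obtain D where D: "D \<in> hedges X" "E = h ` D"
      using E by (auto simp: Y_def)
    have "v \<in> verts X" if "v \<in> D" for v
      using X D that by (auto simp: is_hypergraph_def)
    then have "(\<lambda>v. g \<otimes> h v) ` D = (\<lambda>v. h (\<phi> g v)) ` D"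
      using h_mult[OF g] by (intro image_cong refl) simp
    then have "g <# E = h ` \<phi> g ` D"
      by (simp add: D l_coset_eq_image image_image)
    moreover have "\<phi> g ` D \<in> hedges X"
      using auts g D by (auto simp: acts_by_automorphisms_def hypergraph_iso_def)
    ultimately show ?thesis
      by (simp add: Y_def)
  qed
  note gh = translation_invariant_imp_group_hypergraph[of Y, OF _ Y(1) inv]
  \<comment> \<open>Regularity of \<open>Y\<close> at the single vertex \<open>\<one>\<close> says
    that this collection has \<open>l\<close> members.\<close>
  let ?\<C> = "{E \<in> hedges Y. \<one> \<in> E}"
  have "verts Y = carrier G"
    by (simp add: Y_def)
  moreover have "finite ?\<C> \<and> card ?\<C> = l"
    using Y(3) by (simp add: regular_def Y_def)
  moreover have "\<forall>C\<in>?\<C>. C \<subseteq> carrier G \<and> finite C \<and> card C = k \<and> \<one> \<in> C"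
    using Y(1,2) \<open>verts Y = carrier G\<close> by (auto simp: is_hypergraph_def uniform_def)
  moreover have "isomorphic X (group_hypergraph G ?\<C>)"
    using iso gh(2) \<open>verts Y = carrier G\<close> by (auto simp: isomorphic_def)
  ultimately show ?thesis
    using gh(1) by blast
qed

lemma group_hypergraph_imp_regular_action:
  assumes X: "is_hypergraph X" and \<C>: "\<And>C. C \<in> \<C> \<Longrightarrow> C \<subseteq> carrier G"
    and iso: "hypergraph_iso X (group_hypergraph G \<C>) f"
  shows "\<exists>\<phi>. acts_by_automorphisms G X \<phi> \<and> regular_action G (verts X) \<phi>"
proof -
  have f: "bij_betw f (verts X) (carrier G)"
    using iso by (simp add: hypergraph_iso_def group_hypergraph_def)
  define h where "h = inv_into (verts X) f"
  have fh: "f (h g) = g" and h: "h g \<in> verts X" if "g \<in> carrier G" for g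
    using that f bij_betw_inv_into_right[OF f] bij_betwE[OF bij_betw_inv_into[OF f]]
    by (auto simp: h_def)
  have hf: "h (f v) = v" and fv: "f v \<in> carrier G" if "v \<in> verts X" for v
    using that bij_betw_inv_into_left[OF f] bij_betwE[OF f] by (auto simp: h_def)
  \<comment> \<open>Left translation pulled back along \<open>f\<close>; the restriction to
    \<open>verts X\<close> makes each map extensional.\<close>
  define \<phi> where "\<phi> g = (\<lambda>v\<in>verts X. h (g \<otimes> f v))" for g
  have "group_action G (verts X) \<phi>"
    by (rule group_actionI) (auto simp: \<phi>_def h fh hf fv m_assoc)
  moreover have "hypergraph_iso X X (\<phi> g)" if g: "g \<in> carrier G" for g
  proof -
    have "hypergraph_iso X X (h \<circ> ((\<lambda>s. g \<otimes> s) \<circ> f))"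
      unfolding h_def
      by (rule hypergraph_iso_comp[OF hypergraph_iso_comp[OF iso hypergraph_iso_l_mult[OF \<C> g]]
            hypergraph_iso_inv_into[OF iso X]])
    then show ?thesis
      using hypergraph_iso_cong[OF X, of "\<phi> g" "h \<circ> ((\<lambda>s. g \<otimes> s) \<circ> f)"] by (simp add: \<phi>_def)
  qed
  \<comment> \<open>The witness solves \<open>g \<otimes> f v = f w\<close> for
    \<open>g\<close>.\<close>
  moreover have "\<exists>g\<in>carrier G. \<phi> g v = w" if "v \<in> verts X" "w \<in> verts X" for v w
    using that by (intro bexI[of _ "f w \<otimes> inv f v"]) (auto simp: \<phi>_def hf fv m_assoc)
  moreover have "verts X \<noteq> {}"
    using h[OF one_closed] by auto
  moreover have "stabilizer G \<phi> v = {\<one>}" if v: "v \<in> verts X" for v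
  proof -
    \<comment> \<open>Applying \<open>f\<close> gives \<open>g \<otimes> f v = f v\<close>, and
      \<open>f v\<close> cancels.\<close>
    have "g = \<one>" if "g \<in> carrier G" "h (g \<otimes> f v) = v" for g
      using that v fv[OF v] fh[of "g \<otimes> f v"] by simp
    then show ?thesis
      using v by (auto simp: stabilizer_def \<phi>_def hf fv)
  qed
  ultimately show ?thesis
    unfolding acts_by_automorphisms_def regular_action_def transitive_action_def
      transitive_action_axioms_def by blast
qed

end

theorem theorem4p4:
  fixes X :: "'v hypergraph"
    and G :: "('g, 'm) monoid_scheme"
    and k l :: nat
  assumes "is_hypergraph X" and "group G" and "0 < k" and "0 < l"
  shows "(uniform k X \<and> regular l X \<and>
            (\<exists>\<phi>. acts_by_automorphisms G X \<phi> \<and> regular_action G (verts X) \<phi>))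
         \<longleftrightarrow>
         (\<exists>\<C>. finite \<C> \<and> card \<C> = l \<and>
            (\<forall>C\<in>\<C>. C \<subseteq> carrier G \<and> finite C \<and> card C = k \<and> \<one>\<^bsub>G\<^esub> \<in> C) \<and>
            T_axiom G \<C> \<and>
            isomorphic X (group_hypergraph G \<C>))"
  (is "?L \<longleftrightarrow> ?R")
proof
  interpret group G by fact
  show ?R if ?L
    using that regular_action_imp_group_hypergraph[OF assms(1)] by blast
  show ?L if ?R
  proof -
    obtain \<C> f where \<C>: "finite \<C>" "card \<C> = l" "T_axiom G \<C>"
        "\<And>C. C \<in> \<C> \<Longrightarrow> C \<subseteq> carrier G \<and> finite C \<and> card C = k \<and> \<one>\<^bsub>G\<^esub> \<in> C"
      and iso: "hypergraph_iso X (group_hypergraph G \<C>) f"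
      using \<open>?R\<close> by (auto simp: isomorphic_def)
    let ?Y = "group_hypergraph G \<C>" and ?h = "inv_into (verts X) f"
    \<comment> \<open>Uniformity and regularity are proved for \<open>?Y\<close> and must be carried
      to \<open>X\<close>, hence the inverse isomorphism. That \<open>?Y\<close> is a hypergraph is
      inherited from \<open>X\<close> along \<open>f\<close>.\<close>
    have iso': "hypergraph_iso ?Y X ?h" and Y: "is_hypergraph ?Y"
      using hypergraph_iso_inv_into is_hypergraph_iso iso assms(1) by blast+
    have "uniform k ?Y"
      using \<C>(4) by (intro uniform_group_hypergraph) auto
    moreover have "regular l ?Y"
      using regular_group_hypergraph[OF _ \<C>(3,1)] \<C>(2,4) by auto
    moreover have "\<exists>\<phi>. acts_by_automorphisms G X \<phi> \<and> regular_action G (verts X) \<phi>"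
      using \<C>(4) by (intro group_hypergraph_imp_regular_action[OF assms(1) _ iso]) auto
    ultimately show ?L
      using uniform_iso[OF iso' Y] regular_iso[OF iso' Y] by blast
  qed
qed

end
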